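(* Assume the basic hypotheses stated in the context. Then: (i) for every $\varphi\in L^2$ and all $s_1,s_2\in[0,T]$ with $s_1\le s_2$, one has $$V(s_1,\varphi)\le V(s_2,x_{\varphi,u}(s_2,\cdot))$$ for any measurable control $u\in\mathcal{U}_{\rm ad}[s_1,s_2]$, where $x_{\varphi,u}$ is the trajectory with initial condition $x_{\varphi,u}(s_1,\cdot)=\varphi(\cdot)$ associated with the control $u$; (ii) for every $\varphi\in L^2$ and all $s_1,s_2\in[0,T]$ with $s_1\le s_2$, one has $$V(s_1,\varphi)=\inf_{u\in\mathcal{U}_{\rm ad}[s_1,T]}V(s_2,x_{\varphi,u}(s_2,\cdot)),$$ where $x_{\varphi,u}$ is the trajectory with $x_{\varphi,u}(s_1,\cdot)=\varphi(\cdot)$ associated with $u$.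
   Context: Setup. $T>0$; $(\Omega,d_\Omega,\mu)$ is a metric measure space; $L^2:=L^2(\mu,\Omega;\mathbb{R}^n)$; $U$ is a set-valued map on $[0,T]$ with values in $\mathbb{R}^m$; $f:[0,T]\times\mathbb{R}^n\times\mathbb{R}^m\times\Omega\to\mathbb{R}^n$; $g:\mathbb{R}^n\times\Omega\to\mathbb{R}$. Basic hypotheses. (i) $(\Omega,d_\Omega)$ is compact and $\mu$ is a finite Radon measure. (ii) $U$ is upper semicontinuous with nonempty compact values contained in a fixed compact set $\mathbf{U}\subset\mathbb{R}^m$ (upper semicontinuous: $\{t: U(t)\cap C\ne\emptyset\}$ is closed for every closed $C$). (iii) $f$ is measurable in $t$ and continuous in the other variables, and there are constants $c,k>0$ with $|f(t,x,u,\omega)|\le c(1+|x|)$ and $|f(t,x,u,\omega)-f(t,x',u,\omega)|\le k|x-x'|$ for all $x,x'\in\mathbb{R}^n$, $u\in\mathbb{R}^m$, $\omega\in\Omega$, a.e. $t\in(0,T)$. (iv) $g$ is $\mathcal{L}\otimes\mu$-measurable ($\mathcal{L}$ Lebesgue measure), $g(\cdot,\omega)$ is lower semicontinuous for every $\omega$, and $g(x,\omega)\ge a(\omega)-b|x|^2$ for all $(x,\omega)$, for some $a\in L^1(\mu,\Omega)$ and $b\ge0$. Controls and trajectories. For $0\le s\le\tau\le T$, $\mathcal{U}_{\rm ad}[s,\tau]=\{u\in L^\infty(s,\tau;\mathbb{R}^m):u(t)\in U(t)\text{ a.e. }t\in[s,\tau]\}$. For $\varphi\in L^2$ and $u\in\mathcal{U}_{\rm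 ad}[s,\tau]$, the trajectory $x_{\varphi,u}\in C([s,\tau];L^2)$ with initial condition $\varphi$ at time $s$ is the unique solution of $x(t,\cdot)=\varphi(\cdot)+\int_s^t f(\sigma,x(\sigma,\cdot),u(\sigma),\cdot)\,d\sigma$, $t\in[s,\tau]$. Value function. For $(s,\varphi)\in[0,T]\times L^2$, $V(s,\varphi)=\inf_{u\in\mathcal{U}_{\rm ad}[s,T]}\int_\Omega g(x_{\varphi,u}(T,\omega),\omega)\,d\mu(\omega)\in[-\infty,+\infty]$, where $x_{\varphi,u}$ starts from $\varphi$ at time $s$. *)

theory Defs
  imports "HOL-Analysis.Analysis"
begin

text \<open>The metric space \<open>\<Omega>\<close> is the universe of a type \<open>'w\<close> of class \<open>metric_space\<close>; its
  compactness is an assumption on \<open>UNIV :: 'w set\<close>.\<close>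

text \<open>A finite Radon measure: all Borel sets are measurable and every measurable set is
  approximated from inside by compact sets.  The domain \<open>sets M\<close> may be the Borel sets or
  also contain \<open>M\<close>-null modifications of them, so that both a Borel measure and its completion
  qualify; ``\<open>\<mu>\<close>-measurable'' means measurable with respect to \<open>sets M\<close>.\<close>

definition finite_radon_measure :: "'w::metric_space measure \<Rightarrow> bool" where
  "finite_radon_measure M \<longleftrightarrow>
     finite_measure M \<and> sets borel \<subseteq> sets M \<and>
     (\<forall>A\<in>sets M. emeasure M A = (SUP K\<in>{K. compact K \<and> K \<subseteq> A}. emeasure M K))"

definition usc_map_on :: "real set \<Rightarrow> (real \<Rightarrow> 'c::topological_space set) \<Rightarrow> bool" where
  "usc_map_on I U \<longleftrightarrow> (\<forall>C. closed C \<longrightarrow> closedin (top_of_set I) {t\<in>I. U t \<inter> C \<noteq> {}})"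

definition lsc :: "('a::topological_space \<Rightarrow> real) \<Rightarrow> bool" where
  "lsc h \<longleftrightarrow> (\<forall>x. \<forall>c < h x. \<forall>\<^sub>F y in nhds x. c < h y)"

text \<open>Elements of \<open>L\<^sup>2(\<mu>,\<Omega>;\<real>\<^sup>n)\<close> are handled through representatives, and equality in
  \<open>L\<^sup>2\<close> is equality \<open>M\<close>-almost everywhere.\<close>

definition L2 :: "'w measure \<Rightarrow> ('w \<Rightarrow> real ^ 'n) set" where
  "L2 M = {h \<in> borel_measurable M. integrable M (\<lambda>\<omega>. (norm (h \<omega>))\<^sup>2)}"

definition L2norm :: "'w measure \<Rightarrow> ('w \<Rightarrow> real ^ 'n) \<Rightarrow> real" where
  "L2norm M h = sqrt (LINT \<omega>|M. (norm (h \<omega>))\<^sup>2)"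

definition L2dist :: "'w measure \<Rightarrow> ('w \<Rightarrow> real ^ 'n) \<Rightarrow> ('w \<Rightarrow> real ^ 'n) \<Rightarrow> real" where
  "L2dist M h h' = L2norm M (\<lambda>\<omega>. h \<omega> - h' \<omega>)"

text \<open>The Bochner integral of \<open>L\<^sup>2\<close>-valued functions over a measure \<open>N\<close>.  The library's Bochner
  integral requires the values to form a normed space type, which representatives do not, so the
  usual definition through simple functions is repeated with \<^const>\<open>L2norm\<close> in place of
  \<^const>\<open>norm\<close>.  Like any Bochner integrand, \<open>F\<close> need be \<open>L\<^sup>2\<close>-valued only almost everywhere;
  strong measurability is the almost everywhere convergence of the simple functions.\<close>

definition L2_simple_integral ::
    "'t measure \<Rightarrow> ('t \<Rightarrow> 'w \<Rightarrow> real ^ 'n) \<Rightarrow> 'w \<Rightarrow> real ^ 'n" where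
  "L2_simple_integral N S =
     (\<lambda>\<omega>. \<Sum>h\<in>S ` space N. measure N {\<sigma>\<in>space N. S \<sigma> = h} *\<^sub>R h \<omega>)"

definition has_L2_bochner_integral ::
    "'w measure \<Rightarrow> 't measure \<Rightarrow> ('t \<Rightarrow> 'w \<Rightarrow> real ^ 'n) \<Rightarrow> ('w \<Rightarrow> real ^ 'n) \<Rightarrow> bool" where
  "has_L2_bochner_integral M N F I \<longleftrightarrow>
     finite_measure N \<and> (AE \<sigma> in N. F \<sigma> \<in> L2 M) \<and> I \<in> L2 M \<and>
     (\<exists>S. (\<forall>i::nat. simple_function N (S i) \<and> S i ` space N \<subseteq> L2 M) \<and>
          (AE \<sigma> in N. (\<lambda>i. L2dist M (S i \<sigma>) (F \<sigma>)) \<longlonglongrightarrow> 0) \<and>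
          (\<lambda>i. \<integral>\<^sup>+\<sigma>. ennreal (L2dist M (S i \<sigma>) (F \<sigma>)) \<partial>N) \<longlonglongrightarrow> 0 \<and>
          (\<lambda>i. L2dist M (L2_simple_integral N (S i)) I) \<longlonglongrightarrow> 0)"

definition Uad :: "(real \<Rightarrow> (real ^ 'm) set) \<Rightarrow> real \<Rightarrow> real \<Rightarrow> (real \<Rightarrow> real ^ 'm) set" where
  "Uad U s \<tau> =
     {u \<in> borel_measurable (lebesgue_on {s..\<tau>}).
        (\<exists>B. AE t in lebesgue_on {s..\<tau>}. norm (u t) \<le> B) \<and>
        (AE t in lebesgue_on {s..\<tau>}. u t \<in> U t)}"

text \<open>\<open>trajectory M f s \<tau> \<phi> u x\<close>: the curve \<open>x\<close> belongs to \<open>C([s,\<tau>];L\<^sup>2)\<close> and satisfies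
  \<open>x(t,\<cdot>) = \<phi>(\<cdot>) + \<integral>\<^sub>s\<^sup>t f(\<sigma>,x(\<sigma>,\<cdot>),u(\<sigma>),\<cdot>) d\<sigma>\<close> in \<open>L\<^sup>2\<close> for all \<open>t\<close> in \<open>[s,\<tau>]\<close>.\<close>

definition trajectory ::
    "'w measure \<Rightarrow> (real \<Rightarrow> real ^ 'n \<Rightarrow> real ^ 'm \<Rightarrow> 'w \<Rightarrow> real ^ 'n) \<Rightarrow> real \<Rightarrow> real \<Rightarrow>
     ('w \<Rightarrow> real ^ 'n) \<Rightarrow> (real \<Rightarrow> real ^ 'm) \<Rightarrow> (real \<Rightarrow> 'w \<Rightarrow> real ^ 'n) \<Rightarrow> bool" where
  "trajectory M f s \<tau> \<phi> u x \<longleftrightarrow>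
     (\<forall>t\<in>{s..\<tau>}. x t \<in> L2 M) \<and>
     (\<forall>t\<in>{s..\<tau>}. ((\<lambda>r. L2dist M (x r) (x t)) \<longlongrightarrow> 0) (at t within {s..\<tau>})) \<and>
     (\<forall>t\<in>{s..\<tau>}. \<exists>I.
        has_L2_bochner_integral M (lebesgue_on {s..t}) (\<lambda>\<sigma> \<omega>. f \<sigma> (x \<sigma> \<omega>) (u \<sigma>) \<omega>) I \<and>
        (AE \<omega> in M. x t \<omega> = \<phi> \<omega> + I \<omega>))"

text \<open>The integral of \<open>g(h(\<cdot>),\<cdot>)\<close> as an extended real.  Under the lower bound on \<open>g\<close> the negative
  part has finite integral for every \<open>h\<close> in \<open>L\<^sup>2\<close>, so \<open>\<infinity> - \<infinity>\<close> does not arise.\<close>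

definition terminal_cost ::
    "'w measure \<Rightarrow> (real ^ 'n \<Rightarrow> 'w \<Rightarrow> real) \<Rightarrow> ('w \<Rightarrow> real ^ 'n) \<Rightarrow> ereal" where
  "terminal_cost M g h =
     enn2ereal (\<integral>\<^sup>+\<omega>. ennreal (g (h \<omega>) \<omega>) \<partial>M) - enn2ereal (\<integral>\<^sup>+\<omega>. ennreal (- g (h \<omega>) \<omega>) \<partial>M)"

text \<open>A control determines its trajectory up to equality in \<open>L\<^sup>2\<close> at each time, so letting \<open>x\<close> range
  over all representatives does not change the infimum.\<close>

definition value_function ::
    "real \<Rightarrow> 'w measure \<Rightarrow> (real \<Rightarrow> (real ^ 'm) set) \<Rightarrow>
     (real \<Rightarrow> real ^ 'n \<Rightarrow> real ^ 'm \<Rightarrow> 'w \<Rightarrow> real ^ 'n) \<Rightarrow> (real ^ 'n \<Rightarrow> 'w \<Rightarrow> real) \<Rightarrow>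
     real \<Rightarrow> ('w \<Rightarrow> real ^ 'n) \<Rightarrow> ereal" where
  "value_function T M U f g s \<phi> =
     Inf {terminal_cost M g (x T) | u x. u \<in> Uad U s T \<and> trajectory M f s T \<phi> u x}"

text \<open>The cost and the value function depend only on the class of their argument in \<open>L\<^sup>2\<close>.\<close>

lemma terminal_cost_cong_AE:
  assumes "AE \<omega> in M. h \<omega> = h' \<omega>"
  shows "terminal_cost M g h = terminal_cost M g h'"
proof -
  have "(\<integral>\<^sup>+\<omega>. ennreal (g (h \<omega>) \<omega>) \<partial>M) = (\<integral>\<^sup>+\<omega>. ennreal (g (h' \<omega>) \<omega>) \<partial>M)"
    by (rule nn_integral_cong_AE) (use assms in eventually_elim, simp)
  moreover have "(\<integral>\<^sup>+\<omega>. ennreal (- g (h \<omega>) \<omega>) \<partial>M) = (\<integral>\<^sup>+\<omega>. ennreal (- g (h' \<omega>) \<omega>) \<partial>M)"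
    by (rule nn_integral_cong_AE) (use assms in eventually_elim, simp)
  ultimately show ?thesis
    by (simp add: terminal_cost_def)
qed

lemma trajectory_cong_AE:
  assumes "AE \<omega> in M. \<phi> \<omega> = \<phi>' \<omega>" "trajectory M f s \<tau> \<phi> u x"
  shows "trajectory M f s \<tau> \<phi>' u x"
proof -
  have "AE \<omega> in M. x t \<omega> = \<phi>' \<omega> + I \<omega>" if "AE \<omega> in M. x t \<omega> = \<phi> \<omega> + I \<omega>" for t I
    using that assms(1) by eventually_elim simp
  with assms(2) show ?thesis
    unfolding trajectory_def by meson
qed

lemma value_function_cong_AE:
  assumes "AE \<omega> in M. \<phi> \<omega> = \<phi>' \<omega>"
  shows "value_function T M U f g s \<phi> = value_function T M U f g s \<phi>'"
proof -
  have "AE \<omega> in M. \<phi>' \<omega> = \<phi> \<omega>"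
    using assms by eventually_elim simp
  then have "trajectory M f s T \<phi> u x \<longleftrightarrow> trajectory M f s T \<phi>' u x" for u x
    using assms trajectory_cong_AE by blast
  then show ?thesis
    by (simp add: value_function_def)
qed

end

theory Submission
  imports Defs
begin

text \<open>
  The dynamic programming principle holds because controls and trajectories can be cut and glued
  at an intermediate time \<open>r\<close>.  A trajectory on \<open>[s,r]\<close> followed by one on \<open>[r,T]\<close> that starts where
  the first ends is a trajectory on \<open>[s,T]\<close> with the same terminal cost as the second
  (\<open>trajectory_append\<close>, \<open>Uad_append\<close>); so every competitor for \<open>V(r, x(r))\<close> yields a competitor for
  \<open>V(s, \<phi>)\<close>, which is the monotonicity of \<open>V\<close> along trajectories.  Conversely, the part on \<open>[r,T]\<close>
  of a trajectory on \<open>[s,T]\<close> is a competitor for \<open>V(r, x(r))\<close> (\<open>trajectory_restrict_right\<close>), so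
  \<open>V(r, x(r))\<close> is at most the cost of the trajectory.  Taking the infimum over all trajectories on
  \<open>[s,T]\<close> gives one inequality of the principle, and the monotonicity gives the other.

  Gluing and cutting rest on the additivity of the \<open>L\<^sup>2\<close>-valued Bochner integral in the interval.
  Gluing two approximating sequences of simple functions at \<open>r\<close> gives one for the whole interval
  (\<open>has_L2_bochner_integral_append\<close>).  For cutting, let \<open>I\<close> and \<open>J\<close> be the integrals over \<open>[s,t]\<close> and
  \<open>[s,r]\<close>.  A sequence approximating on \<open>[s,t]\<close> also approximates on \<open>[s,r]\<close>, but \<open>J\<close> is
  given as the limit of a different sequence; that the limit is the same for all
  approximating sequences is \<open>L2_approximates_imp_simple_integral_tendsto\<close>.  The simple integrals over
  \<open>[r,t]\<close> then converge to \<open>I - J\<close> (\<open>has_L2_bochner_integral_diff_ivl\<close>).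
\<close>

section \<open>The seminorm of \<open>L\<^sup>2\<close>\<close>

lemma L2_add:
  assumes "h \<in> L2 M" "h' \<in> L2 M"
  shows "(\<lambda>\<omega>. h \<omega> + h' \<omega>) \<in> L2 M"
proof -
  have [measurable]: "h \<in> borel_measurable M" "h' \<in> borel_measurable M"
    and int: "integrable M (\<lambda>\<omega>. 2 * (norm (h \<omega>))\<^sup>2 + 2 * (norm (h' \<omega>))\<^sup>2)"
    using assms by (auto simp: L2_def)
  have "(norm (h \<omega> + h' \<omega>))\<^sup>2 \<le> 2 * (norm (h \<omega>))\<^sup>2 + 2 * (norm (h' \<omega>))\<^sup>2" for \<omega>
  proof -
    have "(norm (h \<omega> + h' \<omega>))\<^sup>2 \<le> (norm (h \<omega>) + norm (h' \<omega>))\<^sup>2"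
      by (intro power_mono norm_triangle_ineq) simp
    also have "\<dots> \<le> 2 * (norm (h \<omega>))\<^sup>2 + 2 * (norm (h' \<omega>))\<^sup>2"
      using sum_squares_bound[of "norm (h \<omega>)" "norm (h' \<omega>)"] by (simp add: power2_sum)
    finally show ?thesis .
  qed
  then have "integrable M (\<lambda>\<omega>. (norm (h \<omega> + h' \<omega>))\<^sup>2)"
    by (intro Bochner_Integration.integrable_bound[OF int]) auto
  then show ?thesis
    by (simp add: L2_def)
qed

lemma L2_scaleR:
  assumes "h \<in> L2 M"
  shows "(\<lambda>\<omega>. r *\<^sub>R h \<omega>) \<in> L2 M"
  using assms by (auto simp: L2_def power_mult_distrib)

lemma L2_diff:
  assumes "h \<in> L2 M" "h' \<in> L2 M"
  shows "(\<lambda>\<omega>. h \<omega> - h' \<omega>) \<in> L2 M"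
  using L2_add[OF assms(1) L2_scaleR[OF assms(2), of "-1"]] by simp

lemma L2_sum:
  assumes "\<And>i. i \<in> A \<Longrightarrow> h i \<in> L2 M"
  shows "(\<lambda>\<omega>. \<Sum>i\<in>A. h i \<omega>) \<in> L2 M"
  using assms
proof (induction A rule: infinite_finite_induct)
  case (insert i A)
  then show ?case
    by (simp add: L2_add)
qed (simp_all add: L2_def)

lemma L2norm_nonneg [simp]: "0 \<le> L2norm M h"
  by (simp add: L2norm_def)

lemma L2dist_nonneg [simp]: "0 \<le> L2dist M h h'"
  by (simp add: L2dist_def)

lemma L2norm_cong_AE:
  assumes "h \<in> L2 M" "h' \<in> L2 M" "AE \<omega> in M. norm (h \<omega>) = norm (h' \<omega>)"
  shows "L2norm M h = L2norm M h'"
proof -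
  have [measurable]: "h \<in> borel_measurable M" "h' \<in> borel_measurable M"
    using assms by (auto simp: L2_def)
  show ?thesis
    unfolding L2norm_def using assms(3)
    by (intro arg_cong[where f=sqrt] integral_cong_AE) (auto elim: eventually_mono)
qed

lemma L2norm_scaleR: "L2norm M (\<lambda>\<omega>. r *\<^sub>R h \<omega>) = \<bar>r\<bar> * L2norm M h"
  by (simp add: L2norm_def power_mult_distrib real_sqrt_mult)

lemma L2norm_eq_0_iff:
  assumes "h \<in> L2 M"
  shows "L2norm M h = 0 \<longleftrightarrow> (AE \<omega> in M. h \<omega> = 0)"
  using assms by (simp add: L2norm_def L2_def integral_nonneg_eq_0_iff_AE)

text \<open>
  Minkowski's inequality.  With \<open>A\<close> and \<open>B\<close> the two norms,
  \<open>(p + q)\<^sup>2 \<le> (1 + B / A) p\<^sup>2 + (1 + A / B) q\<^sup>2\<close> holds pointwise for \<open>A, B > 0\<close>, and the weights are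
  chosen so that the right-hand side integrates to exactly \<open>(A + B)\<^sup>2\<close>.
\<close>

lemma L2norm_triangle:
  assumes h: "h \<in> L2 M" and h': "h' \<in> L2 M"
  shows "L2norm M (\<lambda>\<omega>. h \<omega> + h' \<omega>) \<le> L2norm M h + L2norm M h'"
proof -
  define A B where "A = L2norm M h" and "B = L2norm M h'"
  have sqA: "(LINT \<omega>|M. (norm (h \<omega>))\<^sup>2) = A\<^sup>2" and sqB: "(LINT \<omega>|M. (norm (h' \<omega>))\<^sup>2) = B\<^sup>2"
    by (simp_all add: A_def B_def L2norm_def)
  have int: "integrable M (\<lambda>\<omega>. (norm (h \<omega>))\<^sup>2)" "integrable M (\<lambda>\<omega>. (norm (h' \<omega>))\<^sup>2)"
    and sum: "(\<lambda>\<omega>. h \<omega> + h' \<omega>) \<in> L2 M"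
    using h h' L2_add by (auto simp: L2_def)
  consider "A = 0" | "B = 0" | "A > 0" "B > 0"
    using L2norm_nonneg[of M h] L2norm_nonneg[of M h'] unfolding A_def B_def by linarith
  then show ?thesis
  proof cases
    case 1
    then have "AE \<omega> in M. h \<omega> = 0"
      using L2norm_eq_0_iff[OF h] by (simp add: A_def)
    then have "L2norm M (\<lambda>\<omega>. h \<omega> + h' \<omega>) = L2norm M h'"
      by (intro L2norm_cong_AE sum h') (auto elim: eventually_mono)
    then show ?thesis
      by simp
  next
    case 2
    then have "AE \<omega> in M. h' \<omega> = 0"
      using L2norm_eq_0_iff[OF h'] by (simp add: B_def)
    then have "L2norm M (\<lambda>\<omega>. h \<omega> + h' \<omega>) = L2norm M h"
      by (intro L2norm_cong_AE sum h) (auto elim: eventually_mono)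
    then show ?thesis
      by simp
  next
    case 3
    have "(norm (h \<omega> + h' \<omega>))\<^sup>2 \<le> (1 + B / A) * (norm (h \<omega>))\<^sup>2 + (1 + A / B) * (norm (h' \<omega>))\<^sup>2" for \<omega>
    proof -
      define p q where "p = norm (h \<omega>)" and "q = norm (h' \<omega>)"
      have "0 \<le> (B * p - A * q)\<^sup>2 / (A * B)"
        using 3 by simp
      also have "\<dots> = (B / A) * p\<^sup>2 + (A / B) * q\<^sup>2 - 2 * p * q"
        using 3 by (simp add: power2_eq_square field_simps)
      finally have "(p + q)\<^sup>2 \<le> (1 + B / A) * p\<^sup>2 + (1 + A / B) * q\<^sup>2"
        by (simp add: power2_sum algebra_simps)
      moreover have "(norm (h \<omega> + h' \<omega>))\<^sup>2 \<le> (p + q)\<^sup>2"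
        unfolding p_def q_def by (intro power_mono norm_triangle_ineq) simp
      ultimately show ?thesis
        unfolding p_def q_def by linarith
    qed
    then have "(LINT \<omega>|M. (norm (h \<omega> + h' \<omega>))\<^sup>2)
        \<le> (LINT \<omega>|M. (1 + B / A) * (norm (h \<omega>))\<^sup>2 + (1 + A / B) * (norm (h' \<omega>))\<^sup>2)"
      using int sum by (intro integral_mono) (auto simp: L2_def)
    also have "\<dots> = (1 + B / A) * A\<^sup>2 + (1 + A / B) * B\<^sup>2"
      using int by (simp add: sqA sqB)
    also have "\<dots> = (A + B)\<^sup>2"
      using 3 by (simp add: power2_eq_square field_simps)
    finally show ?thesis
      unfolding L2norm_def[of M "\<lambda>\<omega>. h \<omega> + h' \<omega>"]
      using 3 by (intro real_le_lsqrt) (auto simp: A_def B_def)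
  qed
qed

lemma L2norm_sum_le:
  assumes "\<And>i. i \<in> A \<Longrightarrow> h i \<in> L2 M"
  shows "L2norm M (\<lambda>\<omega>. \<Sum>i\<in>A. h i \<omega>) \<le> (\<Sum>i\<in>A. L2norm M (h i))"
  using assms
proof (induction A rule: infinite_finite_induct)
  case (insert i A)
  have "L2norm M (\<lambda>\<omega>. \<Sum>i\<in>insert i A. h i \<omega>) \<le> L2norm M (h i) + L2norm M (\<lambda>\<omega>. \<Sum>i\<in>A. h i \<omega>)"
    using insert.hyps insert.prems L2norm_triangle[of "h i" M "\<lambda>\<omega>. \<Sum>i\<in>A. h i \<omega>"] L2_sum[of A h M]
    by simp
  with insert show ?case
    by fastforce
qed (simp_all add: L2norm_def)

lemma L2dist_commute: "L2dist M h h' = L2dist M h' h"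
  by (simp add: L2dist_def L2norm_def norm_minus_commute)

lemma L2dist_triangle:
  assumes "h \<in> L2 M" "h' \<in> L2 M" "h'' \<in> L2 M"
  shows "L2dist M h h'' \<le> L2dist M h h' + L2dist M h' h''"
  using L2norm_triangle[OF L2_diff[OF assms(1,2)] L2_diff[OF assms(2,3)]] by (simp add: L2dist_def)

lemma L2dist_add:
  assumes "h1 \<in> L2 M" "h1' \<in> L2 M" "h2 \<in> L2 M" "h2' \<in> L2 M"
  shows "L2dist M (\<lambda>\<omega>. h1 \<omega> + h2 \<omega>) (\<lambda>\<omega>. h1' \<omega> + h2' \<omega>) \<le> L2dist M h1 h1' + L2dist M h2 h2'"
  using L2norm_triangle[OF L2_diff[OF assms(1,2)] L2_diff[OF assms(3,4)]]
  by (simp add: L2dist_def algebra_simps)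

lemma L2dist_diff:
  assumes "h1 \<in> L2 M" "h1' \<in> L2 M" "h2 \<in> L2 M" "h2' \<in> L2 M"
  shows "L2dist M (\<lambda>\<omega>. h1 \<omega> - h2 \<omega>) (\<lambda>\<omega>. h1' \<omega> - h2' \<omega>) \<le> L2dist M h1 h1' + L2dist M h2 h2'"
  using L2norm_triangle[OF L2_diff[OF assms(1,2)] L2_diff[OF assms(4,3)]]
  unfolding L2dist_commute[of M h2] by (simp add: L2dist_def algebra_simps)

lemma L2dist_cong_AE:
  assumes "h \<in> L2 M" "h' \<in> L2 M" "h2 \<in> L2 M" "h2' \<in> L2 M"
    "AE \<omega> in M. h \<omega> = h' \<omega>" "AE \<omega> in M. h2 \<omega> = h2' \<omega>"
  shows "L2dist M h h2 = L2dist M h' h2'"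
  unfolding L2dist_def using assms(5,6)
  by (intro L2norm_cong_AE L2_diff assms(1-4)) auto

section \<open>Integrals of simple functions\<close>

lemma simple_function_pointwise_integrable:
  fixes S :: "'t \<Rightarrow> 'w \<Rightarrow> real ^ 'n"
  assumes "finite_measure N" "simple_function N S"
  shows "Bochner_Integration.simple_bochner_integrable N (\<lambda>\<sigma>. S \<sigma> \<omega>)"
proof -
  interpret finite_measure N by fact
  show ?thesis
    using simple_function_compose1[OF assms(2), of "\<lambda>h. h \<omega>"]
    by (auto intro!: simple_bochner_integrable.intros)
qed

text \<open>
  Evaluating at \<open>\<omega>\<close> turns the \<open>L\<^sup>2\<close>-valued integral of a simple function into a Bochner integral
  in \<open>\<real>\<^sup>n\<close>.  Linearity and additivity in the domain are thereby inherited from the latter, without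
  common refinements of level sets.
\<close>

lemma L2_simple_integral_eq_pointwise:
  assumes "finite_measure N" "simple_function N S"
  shows "L2_simple_integral N S \<omega> = (LINT \<sigma>|N. S \<sigma> \<omega>)"
proof -
  note sb = simple_function_pointwise_integrable[OF assms]
  have "(LINT \<sigma>|N. S \<sigma> \<omega>) = Bochner_Integration.simple_bochner_integral N (\<lambda>\<sigma>. S \<sigma> \<omega>)"
    using sb by (rule simple_bochner_integrable_eq_integral[symmetric])
  also have "\<dots> = L2_simple_integral N S \<omega>"
    unfolding L2_simple_integral_def
    by (rule simple_bochner_integral_partition[OF sb assms(2)]) simp_all
  finally show ?thesis ..
qed

lemma L2_simple_integral_in_L2:
  assumes "S ` space N \<subseteq> L2 M"
  shows "L2_simple_integral N S \<in> L2 M"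
  unfolding L2_simple_integral_def using assms by (intro L2_sum L2_scaleR) auto

lemma L2norm_simple_integral_le:
  assumes "finite_measure N" "simple_function N S" "S ` space N \<subseteq> L2 M"
  shows "ennreal (L2norm M (L2_simple_integral N S)) \<le> (\<integral>\<^sup>+\<sigma>. ennreal (L2norm M (S \<sigma>)) \<partial>N)"
proof -
  interpret finite_measure N by fact
  have "L2norm M (L2_simple_integral N S)
      \<le> (\<Sum>h\<in>S ` space N. L2norm M (\<lambda>\<omega>. measure N {\<sigma>\<in>space N. S \<sigma> = h} *\<^sub>R h \<omega>))"
    unfolding L2_simple_integral_def using assms(3) by (intro L2norm_sum_le L2_scaleR) auto
  also have "\<dots> = (\<Sum>h\<in>S ` space N. L2norm M h * measure N {\<sigma>\<in>space N. S \<sigma> = h})"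
    by (simp add: L2norm_scaleR mult.commute)
  finally have "ennreal (L2norm M (L2_simple_integral N S))
      \<le> ennreal (\<Sum>h\<in>S ` space N. L2norm M h * measure N {\<sigma>\<in>space N. S \<sigma> = h})"
    by (rule ennreal_leI)
  also have "\<dots> = (\<Sum>h\<in>S ` space N. ennreal (L2norm M h) * emeasure N {\<sigma>\<in>space N. S \<sigma> = h})"
    by (subst sum_ennreal[symmetric]) (auto simp: emeasure_eq_measure ennreal_mult)
  also have "\<dots> = integral\<^sup>S N (\<lambda>\<sigma>. ennreal (L2norm M (S \<sigma>)))"
    by (rule simple_function_partition[symmetric, OF simple_function_compose1[OF assms(2)] assms(2)])
      simp_all
  also have "\<dots> = (\<integral>\<^sup>+\<sigma>. ennreal (L2norm M (S \<sigma>)) \<partial>N)"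
    using simple_function_compose1[OF assms(2)] by (rule nn_integral_eq_simple_integral[symmetric])
  finally show ?thesis .
qed

section \<open>Independence of the approximating sequence\<close>

definition L2_approximates ::
    "'w measure \<Rightarrow> 't measure \<Rightarrow> ('t \<Rightarrow> 'w \<Rightarrow> real ^ 'n) \<Rightarrow> (nat \<Rightarrow> 't \<Rightarrow> 'w \<Rightarrow> real ^ 'n) \<Rightarrow> bool" where
  "L2_approximates M N F S \<longleftrightarrow>
     (\<forall>i. simple_function N (S i) \<and> S i ` space N \<subseteq> L2 M) \<and>
     (AE \<sigma> in N. (\<lambda>i. L2dist M (S i \<sigma>) (F \<sigma>)) \<longlonglongrightarrow> 0) \<and>
     (\<lambda>i. \<integral>\<^sup>+\<sigma>. ennreal (L2dist M (S i \<sigma>) (F \<sigma>)) \<partial>N) \<longlonglongrightarrow> 0"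

lemma has_L2_bochner_integral_iff:
  "has_L2_bochner_integral M N F I \<longleftrightarrow>
     finite_measure N \<and> (AE \<sigma> in N. F \<sigma> \<in> L2 M) \<and> I \<in> L2 M \<and>
     (\<exists>S. L2_approximates M N F S \<and> (\<lambda>i. L2dist M (L2_simple_integral N (S i)) I) \<longlonglongrightarrow> 0)"
  unfolding has_L2_bochner_integral_def L2_approximates_def by auto

lemma LIMSEQ_null_comparison:
  fixes p q :: "nat \<Rightarrow> real"
  assumes "\<And>i. norm (p i) \<le> q i" "q \<longlonglongrightarrow> 0"
  shows "p \<longlonglongrightarrow> 0"
  by (rule Lim_null_comparison[OF always_eventually]) (use assms in auto)

text \<open>
  The integrand in the mean distance of \<open>S i\<close> to \<open>F\<close> need not be measurable when \<open>N\<close> is not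
  complete, whereas splitting an upper bound \<open>\<integral>\<^sup>+ (a + b)\<close> requires measurability.  Almost everywhere
  the integrand equals the limit in \<open>j\<close> of the distances between \<open>S i\<close> and \<open>S j\<close>, which are simple.
\<close>

lemma L2dist_approximation_eq_measurable:
  assumes F: "AE \<sigma> in N. F \<sigma> \<in> L2 M" and S: "L2_approximates M N F S"
  obtains d where "d \<in> borel_measurable N"
    "AE \<sigma> in N. ennreal (L2dist M (S i \<sigma>) (F \<sigma>)) = d \<sigma>"
proof
  let ?d = "\<lambda>\<sigma>. liminf (\<lambda>j. ennreal (L2dist M (S i \<sigma>) (S j \<sigma>)))"
  have "simple_function N (\<lambda>\<sigma>. ennreal (L2dist M (S i \<sigma>) (S j \<sigma>)))" for j
    using S by (intro simple_function_compose2[where h="\<lambda>h h'. ennreal (L2dist M h h')"])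
      (auto simp: L2_approximates_def)
  then show "?d \<in> borel_measurable N"
    by (intro borel_measurable_liminf borel_measurable_simple_function)
  have SL2: "S j \<sigma> \<in> L2 M" if "\<sigma> \<in> space N" for j \<sigma>
    using S that by (auto simp: L2_approximates_def)
  have "AE \<sigma> in N. (\<lambda>j. L2dist M (S j \<sigma>) (F \<sigma>)) \<longlonglongrightarrow> 0"
    using S by (simp add: L2_approximates_def)
  with F AE_space show "AE \<sigma> in N. ennreal (L2dist M (S i \<sigma>) (F \<sigma>)) = ?d \<sigma>"
  proof eventually_elim
    case (elim \<sigma>)
    have "norm (L2dist M (S i \<sigma>) (S j \<sigma>) - L2dist M (S i \<sigma>) (F \<sigma>)) \<le> L2dist M (S j \<sigma>) (F \<sigma>)" for j
      using L2dist_triangle[of "S i \<sigma>" M "S j \<sigma>" "F \<sigma>"]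
        L2dist_triangle[of "S i \<sigma>" M "F \<sigma>" "S j \<sigma>"]
        SL2[of \<sigma>] elim(1,2) L2dist_commute[of M "F \<sigma>" "S j \<sigma>"] by (fastforce simp: abs_le_iff)
    from LIMSEQ_null_comparison[OF this elim(3)]
    have "(\<lambda>j. L2dist M (S i \<sigma>) (S j \<sigma>)) \<longlonglongrightarrow> L2dist M (S i \<sigma>) (F \<sigma>)"
      by (rule LIM_zero_cancel)
    then have "(\<lambda>j. ennreal (L2dist M (S i \<sigma>) (S j \<sigma>))) \<longlonglongrightarrow> ennreal (L2dist M (S i \<sigma>) (F \<sigma>))"
      by (rule tendsto_ennrealI)
    then show ?case
      by (rule lim_imp_Liminf[symmetric, rotated]) simp
  qed
qed

text \<open>
  The integral \<open>I\<close> is witnessed by some sequence \<open>R\<close>.  The norm of the integral of \<open>S i - R i\<close> is at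
  most the mean distance between \<open>S i\<close> and \<open>R i\<close>, hence at most the sum of the mean distances of
  both to \<open>F\<close>, which tends to \<open>0\<close>.
\<close>

lemma L2_approximates_imp_simple_integral_tendsto:
  fixes F :: "'t \<Rightarrow> 'w \<Rightarrow> real ^ 'n"
  assumes I: "has_L2_bochner_integral M N F I" and S: "L2_approximates M N F S"
  shows "(\<lambda>i. L2dist M (L2_simple_integral N (S i)) I) \<longlonglongrightarrow> 0"
proof -
  have fin: "finite_measure N" and F: "AE \<sigma> in N. F \<sigma> \<in> L2 M" and IL2: "I \<in> L2 M"
    using I by (auto simp: has_L2_bochner_integral_def)
  obtain R where R: "L2_approximates M N F R"
    and lim: "(\<lambda>i. L2dist M (L2_simple_integral N (R i)) I) \<longlonglongrightarrow> 0"
    using I by (auto simp: has_L2_bochner_integral_iff)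
  have S_simple: "simple_function N (S i)" and S_L2: "S i ` space N \<subseteq> L2 M" for i
    using S by (auto simp: L2_approximates_def)
  have R_simple: "simple_function N (R i)" and R_L2: "R i ` space N \<subseteq> L2 M" for i
    using R by (auto simp: L2_approximates_def)
  define e where "e i = (\<integral>\<^sup>+\<sigma>. ennreal (L2dist M (S i \<sigma>) (F \<sigma>)) \<partial>N)
    + (\<integral>\<^sup>+\<sigma>. ennreal (L2dist M (R i \<sigma>) (F \<sigma>)) \<partial>N)" for i
  have bound: "ennreal (L2dist M (L2_simple_integral N (S i)) (L2_simple_integral N (R i))) \<le> e i" for i
  proof -
    define D where "D \<sigma> = (\<lambda>\<omega>. S i \<sigma> \<omega> - R i \<sigma> \<omega>)" for \<sigma>
    have D: "simple_function N D" "D ` space N \<subseteq> L2 M"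
      using simple_function_compose2[OF S_simple R_simple, of "\<lambda>h h' \<omega>. h \<omega> - h' \<omega>" i i]
        S_L2[of i] R_L2[of i]
      by (auto simp: D_def[abs_def] intro!: L2_diff)
    have pointwise: "integrable N (\<lambda>\<sigma>. S i \<sigma> \<omega>)" "integrable N (\<lambda>\<sigma>. R i \<sigma> \<omega>)" for \<omega>
      by (intro integrableI_simple_bochner_integrable simple_function_pointwise_integrable fin S_simple R_simple)+
    have "L2_simple_integral N D = (\<lambda>\<omega>. L2_simple_integral N (S i) \<omega> - L2_simple_integral N (R i) \<omega>)"
      using pointwise
      by (simp add: fun_eq_iff L2_simple_integral_eq_pointwise[OF fin] D S_simple R_simple D_def)
    then have "ennreal (L2dist M (L2_simple_integral N (S i)) (L2_simple_integral N (R i)))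
        = ennreal (L2norm M (L2_simple_integral N D))"
      by (simp add: L2dist_def)
    also have "\<dots> \<le> (\<integral>\<^sup>+\<sigma>. ennreal (L2norm M (D \<sigma>)) \<partial>N)"
      by (rule L2norm_simple_integral_le[OF fin D])
    also have "\<dots> \<le> (\<integral>\<^sup>+\<sigma>. ennreal (L2dist M (S i \<sigma>) (F \<sigma>)) + ennreal (L2dist M (R i \<sigma>) (F \<sigma>)) \<partial>N)"
    proof (rule nn_integral_mono_AE, use F AE_space in eventually_elim)
      case (elim \<sigma>)
      then have "L2norm M (D \<sigma>) \<le> L2dist M (S i \<sigma>) (F \<sigma>) + L2dist M (R i \<sigma>) (F \<sigma>)"
        using L2dist_triangle[of "S i \<sigma>" M "F \<sigma>" "R i \<sigma>"] S_L2[of i] R_L2[of i]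
        by (auto simp: D_def L2dist_commute[of M "F \<sigma>"] simp flip: L2dist_def)
      then show ?case
        by (simp flip: ennreal_plus)
    qed
    also have "\<dots> = e i"
    proof -
      obtain d1 where d1[measurable]: "d1 \<in> borel_measurable N"
        and d1_eq: "AE \<sigma> in N. ennreal (L2dist M (S i \<sigma>) (F \<sigma>)) = d1 \<sigma>"
        using L2dist_approximation_eq_measurable[OF F S] .
      obtain d2 where d2[measurable]: "d2 \<in> borel_measurable N"
        and d2_eq: "AE \<sigma> in N. ennreal (L2dist M (R i \<sigma>) (F \<sigma>)) = d2 \<sigma>"
        using L2dist_approximation_eq_measurable[OF F R] .
      have "(\<integral>\<^sup>+\<sigma>. ennreal (L2dist M (S i \<sigma>) (F \<sigma>)) + ennreal (L2dist M (R i \<sigma>) (F \<sigma>)) \<partial>N)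
          = (\<integral>\<^sup>+\<sigma>. d1 \<sigma> + d2 \<sigma> \<partial>N)"
        by (rule nn_integral_cong_AE) (use d1_eq d2_eq in eventually_elim, simp)
      also have "\<dots> = (\<integral>\<^sup>+\<sigma>. d1 \<sigma> \<partial>N) + (\<integral>\<^sup>+\<sigma>. d2 \<sigma> \<partial>N)"
        by (rule nn_integral_add) measurable
      also have "\<dots> = e i"
        using nn_integral_cong_AE[OF d1_eq] nn_integral_cong_AE[OF d2_eq] by (simp add: e_def)
      finally show ?thesis .
    qed
    finally show ?thesis .
  qed
  have "e \<longlonglongrightarrow> 0 + 0"
    unfolding e_def using S R by (intro tendsto_add) (auto simp: L2_approximates_def)
  then have "e \<longlonglongrightarrow> ennreal 0"
    by simp
  then have "(\<lambda>i. ennreal (L2dist M (L2_simple_integral N (S i)) (L2_simple_integral N (R i)))) \<longlonglongrightarrow> ennreal 0"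
    by (rule tendsto_sandwich[OF _ _ tendsto_const, rotated 2]) (use bound in auto)
  then have "(\<lambda>i. L2dist M (L2_simple_integral N (S i)) (L2_simple_integral N (R i))) \<longlonglongrightarrow> 0"
    by (rule tendsto_ennrealD) simp_all
  from tendsto_add[OF this lim]
  have "(\<lambda>i. L2dist M (L2_simple_integral N (S i)) (L2_simple_integral N (R i))
      + L2dist M (L2_simple_integral N (R i)) I) \<longlonglongrightarrow> 0"
    by simp
  moreover have "norm (L2dist M (L2_simple_integral N (S i)) I)
      \<le> L2dist M (L2_simple_integral N (S i)) (L2_simple_integral N (R i))
        + L2dist M (L2_simple_integral N (R i)) I" for i
    using L2dist_triangle[OF L2_simple_integral_in_L2[OF S_L2] L2_simple_integral_in_L2[OF R_L2] IL2]
    by simp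
  ultimately show ?thesis
    by (rule LIMSEQ_null_comparison[rotated])
qed

section \<open>Cutting and gluing over intervals\<close>

text \<open>
  For a nonmeasurable integrand, subadditivity in the domain can still be checked on the simple
  functions below the integrand, whereas additivity in the integrand may fail.
\<close>

lemma nn_integral_Un_le:
  assumes [measurable]: "A \<in> sets N" "B \<in> sets N"
  shows "(\<integral>\<^sup>+x. h x * indicator (A \<union> B) x \<partial>N)
    \<le> (\<integral>\<^sup>+x. h x * indicator A x \<partial>N) + (\<integral>\<^sup>+x. h x * indicator B x \<partial>N)"
  unfolding nn_integral_def[of N "\<lambda>x. h x * indicator (A \<union> B) x"]
proof (rule SUP_least, safe)
  fix g assume g: "simple_function N g" and le: "g \<le> (\<lambda>x. h x * indicator (A \<union> B) x)"
  have [measurable]: "g \<in> borel_measurable N"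
    by (rule borel_measurable_simple_function[OF g])
  have le': "g x \<le> h x * indicator (A \<union> B) x" for x
    using le by (simp add: le_fun_def)
  have "integral\<^sup>S N g = (\<integral>\<^sup>+x. g x \<partial>N)"
    using g by (rule nn_integral_eq_simple_integral[symmetric])
  also have "\<dots> \<le> (\<integral>\<^sup>+x. g x * indicator A x + g x * indicator B x \<partial>N)"
  proof (rule nn_integral_mono)
    show "g x \<le> g x * indicator A x + g x * indicator B x" for x
      using le'[of x] by (auto split: split_indicator)
  qed
  also have "\<dots> = (\<integral>\<^sup>+x. g x * indicator A x \<partial>N) + (\<integral>\<^sup>+x. g x * indicator B x \<partial>N)"
    by (rule nn_integral_add) measurable
  also have "\<dots> \<le> (\<integral>\<^sup>+x. h x * indicator A x \<partial>N) + (\<integral>\<^sup>+x. h x * indicator B x \<partial>N)"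
  proof (intro add_mono nn_integral_mono)
    show "g x * indicator A x \<le> h x * indicator A x" for x
      using le'[of x] by (auto split: split_indicator)
    show "g x * indicator B x \<le> h x * indicator B x" for x
      using le'[of x] by (auto split: split_indicator)
  qed
  finally show "integral\<^sup>S N g
    \<le> (\<integral>\<^sup>+x. h x * indicator A x \<partial>N) + (\<integral>\<^sup>+x. h x * indicator B x \<partial>N)" .
qed

lemma ivl_Un: "s \<le> r \<Longrightarrow> r \<le> t \<Longrightarrow> {s..t} = {s..r} \<union> {r..t::real}"
  by auto

lemma AE_lebesgue_on_neq: "A \<in> sets lebesgue \<Longrightarrow> AE \<sigma> in lebesgue_on A. \<sigma> \<noteq> (r::real)"
  using AE_completion[OF AE_lborel_singleton[of r]]
  by (subst AE_restrict_space_iff) (auto elim: eventually_mono)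

lemma AE_lebesgue_on_subset:
  assumes "AE \<sigma> in lebesgue_on A. P \<sigma>" "B \<subseteq> A" "A \<in> sets lebesgue" "B \<in> sets lebesgue"
  shows "AE \<sigma> in lebesgue_on B. P \<sigma>"
  using assms by (auto simp: AE_restrict_space_iff elim: eventually_mono)

lemma AE_lebesgue_on_append:
  assumes "s \<le> r" "r \<le> t" "AE \<sigma> in lebesgue_on {s..r}. P \<sigma>" "AE \<sigma> in lebesgue_on {r..t}. P \<sigma>"
  shows "AE \<sigma> in lebesgue_on {s..t::real}. P \<sigma>"
proof -
  have "AE \<sigma> in lebesgue. \<sigma> \<in> {s..r} \<longrightarrow> P \<sigma>" "AE \<sigma> in lebesgue. \<sigma> \<in> {r..t} \<longrightarrow> P \<sigma>"
    using assms(3,4) by (simp_all add: AE_restrict_space_iff)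
  then have "AE \<sigma> in lebesgue. \<sigma> \<in> {s..t} \<longrightarrow> P \<sigma>"
    by eventually_elim (auto simp: ivl_Un[OF assms(1,2)])
  then show ?thesis
    by (simp add: AE_restrict_space_iff)
qed

text \<open>
  A function glued at \<open>r\<close> takes its value at \<open>r\<close> from the right piece, so it can differ from the
  left piece at this single point.
\<close>

lemma AE_lebesgue_on_If_left:
  "AE \<sigma> in lebesgue_on {s..r::real}. (if \<sigma> < r then p \<sigma> else q \<sigma>) = p \<sigma>"
proof -
  have "AE \<sigma> in lebesgue_on {s..r}. \<sigma> \<noteq> r"
    by (rule AE_lebesgue_on_neq) simp
  with AE_space show ?thesis
    by eventually_elim auto
qed

lemma AE_lebesgue_on_If_right:
  "AE \<sigma> in lebesgue_on {r..t::real}. (if \<sigma> < r then p \<sigma> else q \<sigma>) = q \<sigma>"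
  by (rule AE_I2) auto

lemma measurable_lebesgue_on_append:
  fixes s r t :: real
  assumes "p \<in> measurable (lebesgue_on {s..r}) N" "q \<in> measurable (lebesgue_on {r..t}) N"
  shows "(\<lambda>\<sigma>. if \<sigma> < r then p \<sigma> else q \<sigma>) \<in> measurable (lebesgue_on {s..t}) N"
proof (subst measurable_If_restrict_space_iff)
  have [measurable]: "{..<r} \<in> sets lebesgue" "{r..} \<in> sets lebesgue"
    by auto
  have "{x \<in> space (lebesgue_on {s..t}). x < r} = {s..t} \<inter> {..<r}"
    by auto
  then show "{x \<in> space (lebesgue_on {s..t}). x < r} \<in> sets (lebesgue_on {s..t})"
    by (simp add: sets_restrict_space)
  have "restrict_space (lebesgue_on {s..t}) {x. x < r} = lebesgue_on ({s..t} \<inter> {..<r})"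
    unfolding lessThan_def[symmetric] by (rule restrict_restrict_space) auto
  moreover have "restrict_space (lebesgue_on {s..t}) {x. \<not> x < r} = lebesgue_on ({s..t} \<inter> {r..})"
    unfolding not_less atLeast_def[symmetric] by (rule restrict_restrict_space) auto
  moreover have "p \<in> measurable (lebesgue_on ({s..t} \<inter> {..<r})) N"
    by (rule measurable_restrict_mono[OF assms(1)]) auto
  moreover have "q \<in> measurable (lebesgue_on ({s..t} \<inter> {r..})) N"
    by (rule measurable_restrict_mono[OF assms(2)]) auto
  ultimately show "p \<in> measurable (restrict_space (lebesgue_on {s..t}) {x. x < r}) N \<and>
      q \<in> measurable (restrict_space (lebesgue_on {s..t}) {x. \<not> x < r}) N"
    by simp
qed

lemma simple_function_lebesgue_on_subset:
  assumes "simple_function (lebesgue_on A) p" "B \<subseteq> A"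
  shows "simple_function (lebesgue_on B) p"
proof -
  have "p \<in> measurable (lebesgue_on B) (count_space UNIV)"
    using assms by (auto simp: simple_function_eq_measurable elim: measurable_restrict_mono)
  moreover have "finite (p ` B)"
    using assms finite_subset[OF image_mono[OF assms(2), of p]]
    by (simp add: simple_function_eq_measurable)
  ultimately show ?thesis
    by (simp add: simple_function_eq_measurable)
qed

lemma simple_function_lebesgue_on_append:
  fixes s r t :: real
  assumes "simple_function (lebesgue_on {s..r}) p" "simple_function (lebesgue_on {r..t}) q"
  shows "simple_function (lebesgue_on {s..t}) (\<lambda>\<sigma>. if \<sigma> < r then p \<sigma> else q \<sigma>)"
proof -
  have "(\<lambda>\<sigma>. if \<sigma> < r then p \<sigma> else q \<sigma>) ` {s..t} \<subseteq> p ` {s..r} \<union> q ` {r..t}"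
    by auto
  moreover have "finite (p ` {s..r} \<union> q ` {r..t})"
    using assms by (simp add: simple_function_eq_measurable)
  ultimately have "finite ((\<lambda>\<sigma>. if \<sigma> < r then p \<sigma> else q \<sigma>) ` {s..t})"
    by (rule finite_subset)
  then show ?thesis
    using assms measurable_lebesgue_on_append[of p s r _ q t]
    by (simp add: simple_function_eq_measurable)
qed

lemma finite_measure_lebesgue_on_ivl: "finite_measure (lebesgue_on {s..t::real})"
  by (rule finite_measure_lebesgue_on) simp

lemma L2_simple_integral_cong_AE:
  assumes "finite_measure N" "simple_function N S" "simple_function N S'"
    and "AE \<sigma> in N. S \<sigma> = S' \<sigma>"
  shows "L2_simple_integral N S = L2_simple_integral N S'"
proof
  have meas: "(\<lambda>\<sigma>. S \<sigma> \<omega>) \<in> borel_measurable N" "(\<lambda>\<sigma>. S' \<sigma> \<omega>) \<in> borel_measurable N" for \<omega>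
    by (intro borel_measurable_integrable integrableI_simple_bochner_integrable
        simple_function_pointwise_integrable assms)+
  have "AE \<sigma> in N. S \<sigma> \<omega> = S' \<sigma> \<omega>" for \<omega>
    using assms(4) by eventually_elim simp
  then show "L2_simple_integral N S \<omega> = L2_simple_integral N S' \<omega>" for \<omega>
    using integral_cong_AE[OF meas] assms(1-3) by (simp add: L2_simple_integral_eq_pointwise)
qed

lemma L2_simple_integral_append:
  fixes s r t :: real
  assumes "s \<le> r" "r \<le> t" "simple_function (lebesgue_on {s..t}) S"
  shows "L2_simple_integral (lebesgue_on {s..t}) S
    = (\<lambda>\<omega>. L2_simple_integral (lebesgue_on {s..r}) S \<omega> + L2_simple_integral (lebesgue_on {r..t}) S \<omega>)"
proof
  fix \<omega>
  have simple: "simple_function (lebesgue_on {s..r}) S" "simple_function (lebesgue_on {r..t}) S"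
    using assms(1,2) by (auto intro: simple_function_lebesgue_on_subset[OF assms(3)])
  have "integrable (lebesgue_on {p..q}) (\<lambda>\<sigma>. S \<sigma> \<omega>)" if "simple_function (lebesgue_on {p..q}) S" for p q
    by (intro integrableI_simple_bochner_integrable simple_function_pointwise_integrable
        finite_measure_lebesgue_on_ivl that)
  with simple assms(3) have int:
    "integrable lebesgue (\<lambda>\<sigma>. indicator {s..r} \<sigma> *\<^sub>R S \<sigma> \<omega>)"
    "integrable lebesgue (\<lambda>\<sigma>. indicator {r..t} \<sigma> *\<^sub>R S \<sigma> \<omega>)"
    "integrable lebesgue (\<lambda>\<sigma>. indicator {s..t} \<sigma> *\<^sub>R S \<sigma> \<omega>)"
    by (auto simp: integrable_restrict_space)
  have "AE \<sigma> in lebesgue. \<sigma> \<noteq> r"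
    using AE_completion[OF AE_lborel_singleton] .
  then have "AE \<sigma> in lebesgue. indicator {s..t} \<sigma> *\<^sub>R S \<sigma> \<omega>
      = indicator {s..r} \<sigma> *\<^sub>R S \<sigma> \<omega> + indicator {r..t} \<sigma> *\<^sub>R S \<sigma> \<omega>"
    by eventually_elim (use assms in \<open>auto split: split_indicator\<close>)
  then have "(LINT \<sigma>|lebesgue. indicator {s..t} \<sigma> *\<^sub>R S \<sigma> \<omega>)
      = (LINT \<sigma>|lebesgue. indicator {s..r} \<sigma> *\<^sub>R S \<sigma> \<omega> + indicator {r..t} \<sigma> *\<^sub>R S \<sigma> \<omega>)"
    using int by (intro integral_cong_AE) auto
  then show "L2_simple_integral (lebesgue_on {s..t}) S \<omega>
    = L2_simple_integral (lebesgue_on {s..r}) S \<omega> + L2_simple_integral (lebesgue_on {r..t}) S \<omega>"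
    using int simple assms(3)
    by (simp add: L2_simple_integral_eq_pointwise finite_measure_lebesgue_on_ivl integral_restrict_space)
qed

text \<open>The mean distance over a smaller domain is smaller.\<close>

lemma L2_approximates_subset:
  assumes S: "L2_approximates M (lebesgue_on A) F S"
    and sub: "B \<subseteq> A" and A: "A \<in> sets lebesgue" and B: "B \<in> sets lebesgue"
  shows "L2_approximates M (lebesgue_on B) F S"
  unfolding L2_approximates_def
proof (intro conjI allI)
  show "simple_function (lebesgue_on B) (S i)" "S i ` space (lebesgue_on B) \<subseteq> L2 M" for i
  proof -
    have "simple_function (lebesgue_on A) (S i)" and "S i ` A \<subseteq> L2 M"
      using S by (simp_all add: L2_approximates_def)
    then show "simple_function (lebesgue_on B) (S i)" "S i ` space (lebesgue_on B) \<subseteq> L2 M"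
      using simple_function_lebesgue_on_subset[OF _ sub] image_mono[OF sub, of "S i"] by auto
  qed
  show "AE \<sigma> in lebesgue_on B. (\<lambda>i. L2dist M (S i \<sigma>) (F \<sigma>)) \<longlonglongrightarrow> 0"
    by (rule AE_lebesgue_on_subset[OF _ sub A B]) (use S in \<open>simp add: L2_approximates_def\<close>)
  have le: "(\<integral>\<^sup>+\<sigma>. ennreal (L2dist M (S i \<sigma>) (F \<sigma>)) \<partial>lebesgue_on B)
      \<le> (\<integral>\<^sup>+\<sigma>. ennreal (L2dist M (S i \<sigma>) (F \<sigma>)) \<partial>lebesgue_on A)" for i
    unfolding nn_integral_restrict_space[of A lebesgue, simplified, OF A]
      nn_integral_restrict_space[of B lebesgue, simplified, OF B]
    by (rule nn_integral_mono) (use sub in \<open>auto split: split_indicator\<close>)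
  have "(\<lambda>i. \<integral>\<^sup>+\<sigma>. ennreal (L2dist M (S i \<sigma>) (F \<sigma>)) \<partial>lebesgue_on A) \<longlonglongrightarrow> 0"
    using S by (simp add: L2_approximates_def)
  then show "(\<lambda>i. \<integral>\<^sup>+\<sigma>. ennreal (L2dist M (S i \<sigma>) (F \<sigma>)) \<partial>lebesgue_on B) \<longlonglongrightarrow> 0"
    by (rule tendsto_sandwich[OF _ _ tendsto_const, rotated 2]) (use le in auto)
qed

lemma has_L2_bochner_integral_cong_AE:
  assumes I: "has_L2_bochner_integral M N F I" and eq: "AE \<sigma> in N. F \<sigma> = G \<sigma>"
  shows "has_L2_bochner_integral M N G I"
proof -
  have "L2_approximates M N G S" if "L2_approximates M N F S" for S
    unfolding L2_approximates_def
  proof (intro conjI allI)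
    show "simple_function N (S i)" "S i ` space N \<subseteq> L2 M" for i
      using that by (simp_all add: L2_approximates_def)
    have "AE \<sigma> in N. (\<lambda>i. L2dist M (S i \<sigma>) (F \<sigma>)) \<longlonglongrightarrow> 0"
      using that by (simp add: L2_approximates_def)
    with eq show "AE \<sigma> in N. (\<lambda>i. L2dist M (S i \<sigma>) (G \<sigma>)) \<longlonglongrightarrow> 0"
      by eventually_elim simp
    have "(\<integral>\<^sup>+\<sigma>. ennreal (L2dist M (S i \<sigma>) (F \<sigma>)) \<partial>N)
        = (\<integral>\<^sup>+\<sigma>. ennreal (L2dist M (S i \<sigma>) (G \<sigma>)) \<partial>N)" for i
      by (rule nn_integral_cong_AE) (use eq in eventually_elim, simp)
    then show "(\<lambda>i. \<integral>\<^sup>+\<sigma>. ennreal (L2dist M (S i \<sigma>) (G \<sigma>)) \<partial>N) \<longlonglongrightarrow> 0"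
      using that by (simp add: L2_approximates_def)
  qed
  moreover have "AE \<sigma> in N. F \<sigma> \<in> L2 M"
    using I by (simp add: has_L2_bochner_integral_def)
  with eq have "AE \<sigma> in N. G \<sigma> \<in> L2 M"
    by eventually_elim simp
  ultimately show ?thesis
    using I unfolding has_L2_bochner_integral_iff by blast
qed

text \<open>
  The existence of the integral over \<open>[r,t]\<close> comes from the two given integrals: one sequence
  approximates \<open>F\<close> on \<open>[s,t]\<close> and, by restriction, on \<open>[s,r]\<close> and \<open>[r,t]\<close>, and its simple integrals
  over \<open>[r,t]\<close> are differences of those over the other two intervals, whose limits are \<open>I\<close> and \<open>J\<close>.
\<close>

lemma has_L2_bochner_integral_diff_ivl:
  fixes s r t :: real
  assumes "s \<le> r" "r \<le> t"
    and I: "has_L2_bochner_integral M (lebesgue_on {s..t}) F I"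
    and J: "has_L2_bochner_integral M (lebesgue_on {s..r}) F J"
  shows "has_L2_bochner_integral M (lebesgue_on {r..t}) F (\<lambda>\<omega>. I \<omega> - J \<omega>)"
proof -
  have IL2: "I \<in> L2 M" "J \<in> L2 M" and F: "AE \<sigma> in lebesgue_on {s..t}. F \<sigma> \<in> L2 M"
    using I J by (auto simp: has_L2_bochner_integral_def)
  obtain S where S: "L2_approximates M (lebesgue_on {s..t}) F S"
    and lim: "(\<lambda>i. L2dist M (L2_simple_integral (lebesgue_on {s..t}) (S i)) I) \<longlonglongrightarrow> 0"
    using I by (auto simp: has_L2_bochner_integral_iff)
  have S_left: "L2_approximates M (lebesgue_on {s..r}) F S"
    and S_right: "L2_approximates M (lebesgue_on {r..t}) F S"
    using assms by (auto intro: L2_approximates_subset[OF S])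
  have lim_left: "(\<lambda>i. L2dist M (L2_simple_integral (lebesgue_on {s..r}) (S i)) J) \<longlonglongrightarrow> 0"
    by (rule L2_approximates_imp_simple_integral_tendsto[OF J S_left])
  have split: "L2_simple_integral (lebesgue_on {r..t}) (S i)
    = (\<lambda>\<omega>. L2_simple_integral (lebesgue_on {s..t}) (S i) \<omega> - L2_simple_integral (lebesgue_on {s..r}) (S i) \<omega>)" for i
    using S assms(1,2) L2_simple_integral_append[of s r t "S i"] by (simp add: L2_approximates_def)
  have "norm (L2dist M (L2_simple_integral (lebesgue_on {r..t}) (S i)) (\<lambda>\<omega>. I \<omega> - J \<omega>))
      \<le> L2dist M (L2_simple_integral (lebesgue_on {s..t}) (S i)) I
        + L2dist M (L2_simple_integral (lebesgue_on {s..r}) (S i)) J" for i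
  proof -
    have "L2_simple_integral (lebesgue_on {s..t}) (S i) \<in> L2 M"
      "L2_simple_integral (lebesgue_on {s..r}) (S i) \<in> L2 M"
      using S S_left by (simp_all add: L2_approximates_def L2_simple_integral_in_L2)
    then show ?thesis
      unfolding split using L2dist_diff IL2 by simp
  qed
  moreover have "(\<lambda>i. L2dist M (L2_simple_integral (lebesgue_on {s..t}) (S i)) I
        + L2dist M (L2_simple_integral (lebesgue_on {s..r}) (S i)) J) \<longlonglongrightarrow> 0"
    using tendsto_add[OF lim lim_left] by simp
  ultimately have "(\<lambda>i. L2dist M (L2_simple_integral (lebesgue_on {r..t}) (S i)) (\<lambda>\<omega>. I \<omega> - J \<omega>)) \<longlonglongrightarrow> 0"
    by (rule LIMSEQ_null_comparison)
  moreover have "AE \<sigma> in lebesgue_on {r..t}. F \<sigma> \<in> L2 M"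
    using assms(1) by (intro AE_lebesgue_on_subset[OF F]) auto
  ultimately show ?thesis
    unfolding has_L2_bochner_integral_iff
    using S_right finite_measure_lebesgue_on_ivl L2_diff[OF IL2] by blast
qed

lemma has_L2_bochner_integral_append:
  fixes s r t :: real
  assumes sr: "s \<le> r" and rt: "r \<le> t"
    and I: "has_L2_bochner_integral M (lebesgue_on {s..r}) F I"
    and J: "has_L2_bochner_integral M (lebesgue_on {r..t}) F J"
  shows "has_L2_bochner_integral M (lebesgue_on {s..t}) F (\<lambda>\<omega>. I \<omega> + J \<omega>)"
proof -
  have IL2: "I \<in> L2 M" "J \<in> L2 M" and F: "AE \<sigma> in lebesgue_on {s..r}. F \<sigma> \<in> L2 M"
      "AE \<sigma> in lebesgue_on {r..t}. F \<sigma> \<in> L2 M"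
    using I J by (auto simp: has_L2_bochner_integral_def)
  obtain S1 where S1: "L2_approximates M (lebesgue_on {s..r}) F S1"
    and lim1: "(\<lambda>i. L2dist M (L2_simple_integral (lebesgue_on {s..r}) (S1 i)) I) \<longlonglongrightarrow> 0"
    using I by (auto simp: has_L2_bochner_integral_iff)
  obtain S2 where S2: "L2_approximates M (lebesgue_on {r..t}) F S2"
    and lim2: "(\<lambda>i. L2dist M (L2_simple_integral (lebesgue_on {r..t}) (S2 i)) J) \<longlonglongrightarrow> 0"
    using J by (auto simp: has_L2_bochner_integral_iff)
  define S where "S i \<sigma> = (if \<sigma> < r then S1 i \<sigma> else S2 i \<sigma>)" for i \<sigma>
  have eq1: "AE \<sigma> in lebesgue_on {s..r}. S i \<sigma> = S1 i \<sigma>" for i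
    unfolding S_def by (rule AE_lebesgue_on_If_left)
  have eq2: "AE \<sigma> in lebesgue_on {r..t}. S i \<sigma> = S2 i \<sigma>" for i
    unfolding S_def by (rule AE_lebesgue_on_If_right)
  have simple1: "simple_function (lebesgue_on {s..r}) (S1 i)" and L2_1: "S1 i ` {s..r} \<subseteq> L2 M" for i
    using S1 by (auto simp: L2_approximates_def)
  have simple2: "simple_function (lebesgue_on {r..t}) (S2 i)" and L2_2: "S2 i ` {r..t} \<subseteq> L2 M" for i
    using S2 by (auto simp: L2_approximates_def)
  have simple: "simple_function (lebesgue_on {s..t}) (S i)" for i
    using simple_function_lebesgue_on_append[OF simple1 simple2, of i i] unfolding S_def .
  have S_approx: "L2_approximates M (lebesgue_on {s..t}) F S"
    unfolding L2_approximates_def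
  proof (intro conjI allI)
    show "simple_function (lebesgue_on {s..t}) (S i)" for i
      by (rule simple)
    show "S i ` space (lebesgue_on {s..t}) \<subseteq> L2 M" for i
      using L2_1[of i] L2_2[of i] by (auto simp: S_def)
    show "AE \<sigma> in lebesgue_on {s..t}. (\<lambda>i. L2dist M (S i \<sigma>) (F \<sigma>)) \<longlonglongrightarrow> 0"
    proof (rule AE_lebesgue_on_append[OF sr rt])
      have "AE \<sigma> in lebesgue_on {s..r}. \<forall>i. S i \<sigma> = S1 i \<sigma>"
        using eq1 by (simp add: AE_all_countable)
      moreover have "AE \<sigma> in lebesgue_on {s..r}. (\<lambda>i. L2dist M (S1 i \<sigma>) (F \<sigma>)) \<longlonglongrightarrow> 0"
        using S1 by (simp add: L2_approximates_def)
      ultimately show "AE \<sigma> in lebesgue_on {s..r}. (\<lambda>i. L2dist M (S i \<sigma>) (F \<sigma>)) \<longlonglongrightarrow> 0"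
        by eventually_elim simp
      have "AE \<sigma> in lebesgue_on {r..t}. \<forall>i. S i \<sigma> = S2 i \<sigma>"
        using eq2 by (simp add: AE_all_countable)
      moreover have "AE \<sigma> in lebesgue_on {r..t}. (\<lambda>i. L2dist M (S2 i \<sigma>) (F \<sigma>)) \<longlonglongrightarrow> 0"
        using S2 by (simp add: L2_approximates_def)
      ultimately show "AE \<sigma> in lebesgue_on {r..t}. (\<lambda>i. L2dist M (S i \<sigma>) (F \<sigma>)) \<longlonglongrightarrow> 0"
        by eventually_elim simp
    qed
    let ?e = "\<lambda>i. (\<integral>\<^sup>+\<sigma>. ennreal (L2dist M (S1 i \<sigma>) (F \<sigma>)) \<partial>lebesgue_on {s..r})
        + (\<integral>\<^sup>+\<sigma>. ennreal (L2dist M (S2 i \<sigma>) (F \<sigma>)) \<partial>lebesgue_on {r..t})"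
    have le: "(\<integral>\<^sup>+\<sigma>. ennreal (L2dist M (S i \<sigma>) (F \<sigma>)) \<partial>lebesgue_on {s..t}) \<le> ?e i" for i
    proof -
      have "(\<integral>\<^sup>+\<sigma>. ennreal (L2dist M (S i \<sigma>) (F \<sigma>)) \<partial>lebesgue_on {s..t})
        \<le> (\<integral>\<^sup>+\<sigma>. ennreal (L2dist M (S i \<sigma>) (F \<sigma>)) \<partial>lebesgue_on {s..r})
        + (\<integral>\<^sup>+\<sigma>. ennreal (L2dist M (S i \<sigma>) (F \<sigma>)) \<partial>lebesgue_on {r..t})"
        using nn_integral_Un_le[of "{s..r}" lebesgue "{r..t}" "\<lambda>\<sigma>. ennreal (L2dist M (S i \<sigma>) (F \<sigma>))"]
        by (simp add: nn_integral_restrict_space flip: ivl_Un[OF sr rt])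
      also have "(\<integral>\<^sup>+\<sigma>. ennreal (L2dist M (S i \<sigma>) (F \<sigma>)) \<partial>lebesgue_on {s..r})
        = (\<integral>\<^sup>+\<sigma>. ennreal (L2dist M (S1 i \<sigma>) (F \<sigma>)) \<partial>lebesgue_on {s..r})"
        by (rule nn_integral_cong_AE) (use eq1[of i] in eventually_elim, simp)
      also have "(\<integral>\<^sup>+\<sigma>. ennreal (L2dist M (S i \<sigma>) (F \<sigma>)) \<partial>lebesgue_on {r..t})
        = (\<integral>\<^sup>+\<sigma>. ennreal (L2dist M (S2 i \<sigma>) (F \<sigma>)) \<partial>lebesgue_on {r..t})"
        by (rule nn_integral_cong_AE) (use eq2[of i] in eventually_elim, simp)
      finally show ?thesis .
    qed
    have "?e \<longlonglongrightarrow> 0 + 0"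
      using S1 S2 by (intro tendsto_add) (auto simp: L2_approximates_def)
    then have "?e \<longlonglongrightarrow> 0"
      by simp
    then show "(\<lambda>i. \<integral>\<^sup>+\<sigma>. ennreal (L2dist M (S i \<sigma>) (F \<sigma>)) \<partial>lebesgue_on {s..t}) \<longlonglongrightarrow> 0"
      by (rule tendsto_sandwich[OF _ _ tendsto_const, rotated 2]) (use le in auto)
  qed
  have "simple_function (lebesgue_on {s..r}) (S i)" "simple_function (lebesgue_on {r..t}) (S i)" for i
    using sr rt by (auto intro: simple_function_lebesgue_on_subset[OF simple])
  then have split: "L2_simple_integral (lebesgue_on {s..t}) (S i)
    = (\<lambda>\<omega>. L2_simple_integral (lebesgue_on {s..r}) (S1 i) \<omega> + L2_simple_integral (lebesgue_on {r..t}) (S2 i) \<omega>)" for i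
    using L2_simple_integral_append[OF sr rt simple, of i]
      L2_simple_integral_cong_AE[OF finite_measure_lebesgue_on_ivl _ simple1 eq1]
      L2_simple_integral_cong_AE[OF finite_measure_lebesgue_on_ivl _ simple2 eq2]
    by simp
  have "norm (L2dist M (L2_simple_integral (lebesgue_on {s..t}) (S i)) (\<lambda>\<omega>. I \<omega> + J \<omega>))
      \<le> L2dist M (L2_simple_integral (lebesgue_on {s..r}) (S1 i)) I
        + L2dist M (L2_simple_integral (lebesgue_on {r..t}) (S2 i)) J" for i
  proof -
    have "L2_simple_integral (lebesgue_on {s..r}) (S1 i) \<in> L2 M"
      "L2_simple_integral (lebesgue_on {r..t}) (S2 i) \<in> L2 M"
      using L2_1 L2_2 by (simp_all add: L2_simple_integral_in_L2)
    then show ?thesis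
      unfolding split using L2dist_add IL2 by simp
  qed
  moreover have "(\<lambda>i. L2dist M (L2_simple_integral (lebesgue_on {s..r}) (S1 i)) I
        + L2dist M (L2_simple_integral (lebesgue_on {r..t}) (S2 i)) J) \<longlonglongrightarrow> 0"
    using tendsto_add[OF lim1 lim2] by simp
  ultimately have "(\<lambda>i. L2dist M (L2_simple_integral (lebesgue_on {s..t}) (S i)) (\<lambda>\<omega>. I \<omega> + J \<omega>)) \<longlonglongrightarrow> 0"
    by (rule LIMSEQ_null_comparison)
  then show ?thesis
    unfolding has_L2_bochner_integral_iff
    using S_approx finite_measure_lebesgue_on_ivl L2_add[OF IL2] AE_lebesgue_on_append[OF sr rt F]
    by blast
qed

section \<open>Cutting and gluing of controls and trajectories\<close>

lemma Uad_restrict: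
  assumes u: "u \<in> Uad U s \<tau>" and sub: "{s'..\<tau>'} \<subseteq> {s..\<tau>}"
  shows "u \<in> Uad U s' \<tau>'"
proof -
  have "u \<in> borel_measurable (lebesgue_on {s'..\<tau>'})"
    by (rule measurable_restrict_mono[OF _ sub]) (use u in \<open>simp add: Uad_def\<close>)
  moreover obtain B where "AE t in lebesgue_on {s..\<tau>}. norm (u t) \<le> B"
    using u by (auto simp: Uad_def)
  then have "AE t in lebesgue_on {s'..\<tau>'}. norm (u t) \<le> B"
    by (rule AE_lebesgue_on_subset[OF _ sub]) simp_all
  moreover have "AE t in lebesgue_on {s'..\<tau>'}. u t \<in> U t"
    by (rule AE_lebesgue_on_subset[OF _ sub]) (use u in \<open>simp_all add: Uad_def\<close>)
  ultimately show ?thesis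
    unfolding Uad_def by blast
qed

lemma Uad_append:
  assumes sr: "s \<le> r" and r\<tau>: "r \<le> \<tau>" and u: "u \<in> Uad U s r" and v: "v \<in> Uad U r \<tau>"
  shows "(\<lambda>t. if t < r then u t else v t) \<in> Uad U s \<tau>"
proof -
  let ?w = "\<lambda>t. if t < r then u t else v t"
  obtain B where B: "AE t in lebesgue_on {s..r}. norm (u t) \<le> B"
    using u by (auto simp: Uad_def)
  obtain C where C: "AE t in lebesgue_on {r..\<tau>}. norm (v t) \<le> C"
    using v by (auto simp: Uad_def)
  have u_U: "AE t in lebesgue_on {s..r}. u t \<in> U t" and v_U: "AE t in lebesgue_on {r..\<tau>}. v t \<in> U t"
    using u v by (auto simp: Uad_def)
  have left: "AE t in lebesgue_on {s..r}. ?w t = u t" and right: "AE t in lebesgue_on {r..\<tau>}. ?w t = v t"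
    by (rule AE_lebesgue_on_If_left AE_lebesgue_on_If_right)+
  have "AE t in lebesgue_on {s..\<tau>}. norm (?w t) \<le> max B C"
  proof (rule AE_lebesgue_on_append[OF sr r\<tau>])
    show "AE t in lebesgue_on {s..r}. norm (?w t) \<le> max B C"
      using left B by eventually_elim (metis max.coboundedI1)
    show "AE t in lebesgue_on {r..\<tau>}. norm (?w t) \<le> max B C"
      using right C by eventually_elim (metis max.coboundedI2)
  qed
  moreover have "AE t in lebesgue_on {s..\<tau>}. ?w t \<in> U t"
  proof (rule AE_lebesgue_on_append[OF sr r\<tau>])
    show "AE t in lebesgue_on {s..r}. ?w t \<in> U t"
      using left u_U by eventually_elim metis
    show "AE t in lebesgue_on {r..\<tau>}. ?w t \<in> U t"
      using right v_U by eventually_elim metis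
  qed
  moreover have "?w \<in> borel_measurable (lebesgue_on {s..\<tau>})"
    using u v by (intro measurable_lebesgue_on_append) (auto simp: Uad_def)
  ultimately show ?thesis
    unfolding Uad_def by blast
qed

lemma
  assumes "trajectory M f s \<tau> \<phi> u x" "t \<in> {s..\<tau>}"
  shows trajectory_in_L2: "x t \<in> L2 M"
    and trajectory_continuous: "((\<lambda>p. L2dist M (x p) (x t)) \<longlongrightarrow> 0) (at t within {s..\<tau>})"
    and trajectory_integral: "\<exists>I. has_L2_bochner_integral M (lebesgue_on {s..t})
      (\<lambda>\<sigma> \<omega>. f \<sigma> (x \<sigma> \<omega>) (u \<sigma>) \<omega>) I \<and> (AE \<omega> in M. x t \<omega> = \<phi> \<omega> + I \<omega>)"
  using assms unfolding trajectory_def by blast+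

lemma trajectory_restrict_left:
  assumes x: "trajectory M f s \<tau> \<phi> u x" and "r \<le> \<tau>"
  shows "trajectory M f s r \<phi> u x"
  unfolding trajectory_def
proof (intro conjI ballI)
  fix t assume "t \<in> {s..r}"
  then have t: "t \<in> {s..\<tau>}"
    using \<open>r \<le> \<tau>\<close> by auto
  show "x t \<in> L2 M"
    by (rule trajectory_in_L2[OF x t])
  show "((\<lambda>p. L2dist M (x p) (x t)) \<longlongrightarrow> 0) (at t within {s..r})"
    by (rule tendsto_within_subset[OF trajectory_continuous[OF x t]]) (use \<open>r \<le> \<tau>\<close> in auto)
  show "\<exists>I. has_L2_bochner_integral M (lebesgue_on {s..t})
      (\<lambda>\<sigma> \<omega>. f \<sigma> (x \<sigma> \<omega>) (u \<sigma>) \<omega>) I \<and> (AE \<omega> in M. x t \<omega> = \<phi> \<omega> + I \<omega>)"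
    by (rule trajectory_integral[OF x t])
qed

text \<open>
  Subtracting the integral equation at \<open>r\<close> from the one at \<open>t\<close> gives the integral equation started
  at \<open>r\<close>.
\<close>

lemma trajectory_restrict_right:
  assumes x: "trajectory M f s \<tau> \<phi> u x" and "s \<le> r" "r \<le> \<tau>"
  shows "trajectory M f r \<tau> (x r) u x"
  unfolding trajectory_def
proof (intro conjI ballI)
  fix t assume "t \<in> {r..\<tau>}"
  then have t: "t \<in> {s..\<tau>}"
    using \<open>s \<le> r\<close> by auto
  show "x t \<in> L2 M"
    by (rule trajectory_in_L2[OF x t])
  show "((\<lambda>p. L2dist M (x p) (x t)) \<longlongrightarrow> 0) (at t within {r..\<tau>})"
    by (rule tendsto_within_subset[OF trajectory_continuous[OF x t]]) (use \<open>s \<le> r\<close> in auto)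
next
  fix t assume t: "t \<in> {r..\<tau>}"
  let ?F = "\<lambda>\<sigma> \<omega>. f \<sigma> (x \<sigma> \<omega>) (u \<sigma>) \<omega>"
  obtain I where I: "has_L2_bochner_integral M (lebesgue_on {s..t}) ?F I"
    "AE \<omega> in M. x t \<omega> = \<phi> \<omega> + I \<omega>"
    using trajectory_integral[OF x, of t] t \<open>s \<le> r\<close> by auto
  obtain J where J: "has_L2_bochner_integral M (lebesgue_on {s..r}) ?F J"
    "AE \<omega> in M. x r \<omega> = \<phi> \<omega> + J \<omega>"
    using trajectory_integral[OF x, of r] \<open>s \<le> r\<close> \<open>r \<le> \<tau>\<close> by auto
  have "has_L2_bochner_integral M (lebesgue_on {r..t}) ?F (\<lambda>\<omega>. I \<omega> - J \<omega>)"
    using t \<open>s \<le> r\<close> by (intro has_L2_bochner_integral_diff_ivl[OF _ _ I(1) J(1)]) auto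
  moreover have "AE \<omega> in M. x t \<omega> = x r \<omega> + (I \<omega> - J \<omega>)"
    using I(2) J(2) by eventually_elim simp
  ultimately show "\<exists>I. has_L2_bochner_integral M (lebesgue_on {r..t}) ?F I \<and>
      (AE \<omega> in M. x t \<omega> = x r \<omega> + I \<omega>)"
    by blast
qed

text \<open>An integral over a null set vanishes, in particular the one over \<open>[s,s]\<close>.\<close>

lemma trajectory_initial:
  assumes "trajectory M f s \<tau> \<phi> u x" "s \<le> \<tau>"
  shows "AE \<omega> in M. x s \<omega> = \<phi> \<omega>"
proof -
  obtain I where I: "has_L2_bochner_integral M (lebesgue_on {s..s}) (\<lambda>\<sigma> \<omega>. f \<sigma> (x \<sigma> \<omega>) (u \<sigma>) \<omega>) I"
    and xs: "AE \<omega> in M. x s \<omega> = \<phi> \<omega> + I \<omega>"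
    using trajectory_integral[OF assms(1), of s] assms(2) by auto
  have "emeasure (lebesgue_on {s..s}) A = 0" for A
    using emeasure_space[of "lebesgue_on {s..s}" A] by (simp add: emeasure_restrict_space)
  then have "L2_simple_integral (lebesgue_on {s..s}) S = (\<lambda>_. 0)" for S :: "real \<Rightarrow> 'a \<Rightarrow> real ^ 'b"
    by (simp add: L2_simple_integral_def measure_def)
  moreover have "L2dist M (\<lambda>_. 0) I = L2norm M I"
    by (simp add: L2dist_def L2norm_def)
  ultimately have "(\<lambda>i::nat. L2norm M I) \<longlonglongrightarrow> 0" and "I \<in> L2 M"
    using I by (auto simp: has_L2_bochner_integral_iff)
  then have "L2norm M I = 0"
    by (simp add: LIMSEQ_const_iff)
  with \<open>I \<in> L2 M\<close> have "AE \<omega> in M. I \<omega> = 0"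
    by (simp add: L2norm_eq_0_iff)
  with xs show ?thesis
    by eventually_elim simp
qed

text \<open>
  At time \<open>r\<close> the glued curve takes the value \<open>y r\<close>, which is only almost everywhere equal to \<open>x r\<close>.
  On \<open>[s,r]\<close> it is therefore compared with \<open>x\<close> through \<open>L\<^sup>2\<close>-distances, and on \<open>[r,\<tau>]\<close> it is \<open>y\<close>.
  The choice of \<open>y r\<close> makes the terminal values agree also when \<open>r = \<tau>\<close>.
\<close>

lemma trajectory_append:
  assumes sr: "s \<le> r" and r\<tau>: "r \<le> \<tau>"
    and x: "trajectory M f s r \<phi> u x" and y: "trajectory M f r \<tau> (x r) v y"
  shows "trajectory M f s \<tau> \<phi> (\<lambda>t. if t < r then u t else v t) (\<lambda>t. if t < r then x t else y t)"
proof -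
  define w where "w t = (if t < r then u t else v t)" for t
  define z where "z t = (if t < r then x t else y t)" for t
  have y_r: "AE \<omega> in M. y r \<omega> = x r \<omega>"
    by (rule trajectory_initial[OF y r\<tau>])
  have z_left: "AE \<omega> in M. z t \<omega> = x t \<omega>" if "t \<in> {s..r}" for t
    using that y_r by (cases "t = r") (auto simp: z_def)
  have z_right: "z t = y t" if "t \<in> {r..\<tau>}" for t
    using that by (auto simp: z_def)
  have xL2: "x t \<in> L2 M" if "t \<in> {s..r}" for t
    by (rule trajectory_in_L2[OF x that])
  have yL2: "y t \<in> L2 M" if "t \<in> {r..\<tau>}" for t
    by (rule trajectory_in_L2[OF y that])
  have zL2: "z t \<in> L2 M" if "t \<in> {s..\<tau>}" for t
    using that xL2[of t] yL2[of t] by (auto simp: z_def)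
  have "trajectory M f s \<tau> \<phi> w z"
    unfolding trajectory_def
  proof (intro conjI ballI)
    show "z t \<in> L2 M" if "t \<in> {s..\<tau>}" for t
      using that by (rule zL2)
  next
    fix t assume t: "t \<in> {s..\<tau>}"
    \<comment> \<open>The limit is taken on both sides of \<open>r\<close> separately; if \<open>t\<close> lies outside one of the two closed
      intervals, the corresponding filter is trivial.\<close>
    have "((\<lambda>p. L2dist M (z p) (z t)) \<longlongrightarrow> 0) (at t within {s..r})"
    proof (cases "t \<in> {s..r}")
      case True
      have "\<forall>\<^sub>F p in at t within {s..r}. L2dist M (x p) (x t) = L2dist M (z p) (z t)"
        unfolding eventually_at_filter
      proof (intro always_eventually allI impI)
        fix p assume p: "p \<in> {s..r}"
        with True show "L2dist M (x p) (x t) = L2dist M (z p) (z t)"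
          using z_left[OF p] z_left[OF True] xL2[of p] xL2[of t] zL2[of p] zL2[of t] r\<tau>
          by (intro L2dist_cong_AE) (auto elim: eventually_mono)
      qed
      moreover have "((\<lambda>p. L2dist M (x p) (x t)) \<longlongrightarrow> 0) (at t within {s..r})"
        by (rule trajectory_continuous[OF x True])
      ultimately show ?thesis
        by (rule Lim_transform_eventually[rotated])
    next
      case False
      then have "at t within {s..r} = bot"
        using not_in_closure_trivial_limitI[of t "{s..r}"] by simp
      then show ?thesis
        by simp
    qed
    moreover have "((\<lambda>p. L2dist M (z p) (z t)) \<longlongrightarrow> 0) (at t within {r..\<tau>})"
    proof (cases "t \<in> {r..\<tau>}")
      case True
      have "\<forall>\<^sub>F p in at t within {r..\<tau>}. L2dist M (y p) (y t) = L2dist M (z p) (z t)"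
        unfolding eventually_at_filter
        using True by (intro always_eventually) (auto simp: z_right)
      moreover have "((\<lambda>p. L2dist M (y p) (y t)) \<longlongrightarrow> 0) (at t within {r..\<tau>})"
        by (rule trajectory_continuous[OF y True])
      ultimately show ?thesis
        by (rule Lim_transform_eventually[rotated])
    next
      case False
      then have "at t within {r..\<tau>} = bot"
        using not_in_closure_trivial_limitI[of t "{r..\<tau>}"] by simp
      then show ?thesis
        by simp
    qed
    ultimately show "((\<lambda>p. L2dist M (z p) (z t)) \<longlongrightarrow> 0) (at t within {s..\<tau>})"
      unfolding ivl_Un[OF sr r\<tau>] at_within_union by (rule filterlim_sup)
  next
    fix t assume t: "t \<in> {s..\<tau>}"
    let ?F = "\<lambda>\<sigma> \<omega>. f \<sigma> (z \<sigma> \<omega>) (w \<sigma>) \<omega>"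
    have left: "\<exists>I. has_L2_bochner_integral M (lebesgue_on {s..p}) ?F I \<and> (AE \<omega> in M. x p \<omega> = \<phi> \<omega> + I \<omega>)"
      if p: "p \<in> {s..r}" for p
    proof -
      obtain I where I: "has_L2_bochner_integral M (lebesgue_on {s..p}) (\<lambda>\<sigma> \<omega>. f \<sigma> (x \<sigma> \<omega>) (u \<sigma>) \<omega>) I"
        "AE \<omega> in M. x p \<omega> = \<phi> \<omega> + I \<omega>"
        using trajectory_integral[OF x p] by blast
      have "AE \<sigma> in lebesgue_on {s..p}. \<sigma> \<noteq> r"
        by (rule AE_lebesgue_on_neq) simp
      with AE_space have "AE \<sigma> in lebesgue_on {s..p}. (\<lambda>\<omega>. f \<sigma> (x \<sigma> \<omega>) (u \<sigma>) \<omega>) = ?F \<sigma>"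
        by eventually_elim (use p in \<open>auto simp: z_def w_def\<close>)
      from has_L2_bochner_integral_cong_AE[OF I(1) this] I(2) show ?thesis
        by blast
    qed
    show "\<exists>I. has_L2_bochner_integral M (lebesgue_on {s..t}) ?F I \<and> (AE \<omega> in M. z t \<omega> = \<phi> \<omega> + I \<omega>)"
    proof (cases "t < r")
      case True
      then show ?thesis
        using left[of t] t by (auto simp: z_def)
    next
      case False
      obtain I where I: "has_L2_bochner_integral M (lebesgue_on {s..r}) ?F I"
        "AE \<omega> in M. x r \<omega> = \<phi> \<omega> + I \<omega>"
        using left[of r] sr by auto
      obtain J where J: "has_L2_bochner_integral M (lebesgue_on {r..t}) (\<lambda>\<sigma> \<omega>. f \<sigma> (y \<sigma> \<omega>) (v \<sigma>) \<omega>) J"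
        "AE \<omega> in M. y t \<omega> = x r \<omega> + J \<omega>"
        using trajectory_integral[OF y, of t] t False by auto
      have "AE \<sigma> in lebesgue_on {r..t}. (\<lambda>\<omega>. f \<sigma> (y \<sigma> \<omega>) (v \<sigma>) \<omega>) = ?F \<sigma>"
        by (rule AE_I2) (auto simp: z_def w_def)
      then have "has_L2_bochner_integral M (lebesgue_on {r..t}) ?F J"
        by (rule has_L2_bochner_integral_cong_AE[OF J(1)])
      then have "has_L2_bochner_integral M (lebesgue_on {s..t}) ?F (\<lambda>\<omega>. I \<omega> + J \<omega>)"
        using False sr by (intro has_L2_bochner_integral_append[OF _ _ I(1)]) auto
      moreover have "AE \<omega> in M. z t \<omega> = \<phi> \<omega> + (I \<omega> + J \<omega>)"
        using I(2) J(2) by eventually_elim (use False in \<open>simp add: z_def\<close>)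
      ultimately show ?thesis
        by blast
    qed
  qed
  then show ?thesis
    by (simp add: w_def[abs_def] z_def[abs_def])
qed

section \<open>The dynamic programming principle\<close>

lemma value_function_le_along_trajectory:
  assumes "s \<le> r" "r \<le> T" and u: "u \<in> Uad U s r" and x: "trajectory M f s r \<phi> u x"
  shows "value_function T M U f g s \<phi> \<le> value_function T M U f g r (x r)"
  unfolding value_function_def[of T M U f g r]
proof (rule Inf_greatest, safe)
  fix v y assume v: "v \<in> Uad U r T" and y: "trajectory M f r T (x r) v y"
  let ?w = "\<lambda>t. if t < r then u t else v t" and ?z = "\<lambda>t. if t < r then x t else y t"
  have "?w \<in> Uad U s T" "trajectory M f s T \<phi> ?w ?z"
    using Uad_append[OF assms(1,2) u v] trajectory_append[OF assms(1,2) x y] by auto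
  then have "value_function T M U f g s \<phi> \<le> terminal_cost M g (?z T)"
    unfolding value_function_def by (intro Inf_lower CollectI exI[of _ ?w] exI[of _ ?z]) simp
  then show "value_function T M U f g s \<phi> \<le> terminal_cost M g (y T)"
    using \<open>r \<le> T\<close> by simp
qed

lemma value_function_dynamic_programming:
  assumes "s \<le> r" "r \<le> T"
  shows "value_function T M U f g s \<phi> =
    Inf {value_function T M U f g r (x r) | u x. u \<in> Uad U s T \<and> trajectory M f s T \<phi> u x}"
proof (rule antisym)
  show "value_function T M U f g s \<phi> \<le>
    Inf {value_function T M U f g r (x r) | u x. u \<in> Uad U s T \<and> trajectory M f s T \<phi> u x}"
  proof (rule Inf_greatest, safe)
    fix u x assume u: "u \<in> Uad U s T" and x: "trajectory M f s T \<phi> u x"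
    have "u \<in> Uad U s r"
      by (rule Uad_restrict[OF u]) (use assms in auto)
    then show "value_function T M U f g s \<phi> \<le> value_function T M U f g r (x r)"
      by (rule value_function_le_along_trajectory[OF assms _ trajectory_restrict_left[OF x \<open>r \<le> T\<close>]])
  qed
  show "Inf {value_function T M U f g r (x r) | u x. u \<in> Uad U s T \<and> trajectory M f s T \<phi> u x}
    \<le> value_function T M U f g s \<phi>"
    unfolding value_function_def[of T M U f g s]
  proof (rule Inf_greatest, safe)
    fix u x assume u: "u \<in> Uad U s T" and x: "trajectory M f s T \<phi> u x"
    have u': "u \<in> Uad U r T"
      by (rule Uad_restrict[OF u]) (use assms in auto)
    have "Inf {value_function T M U f g r (x r) | u x. u \<in> Uad U s T \<and> trajectory M f s T \<phi> u x}
        \<le> value_function T M U f g r (x r)"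
      by (intro Inf_lower CollectI exI[of _ u] exI[of _ x] conjI refl u x)
    also have "\<dots> \<le> terminal_cost M g (x T)"
      unfolding value_function_def
      by (intro Inf_lower CollectI exI[of _ u] exI[of _ x] conjI refl u' trajectory_restrict_right[OF x assms])
    finally show "Inf {value_function T M U f g r (x r) | u x. u \<in> Uad U s T \<and> trajectory M f s T \<phi> u x}
        \<le> terminal_cost M g (x T)" .
  qed
qed

theorem theorem2p2:
  fixes T :: real
    and M :: "'w::metric_space measure"
    and U :: "real \<Rightarrow> (real ^ 'm) set" and UU :: "(real ^ 'm) set"
    and f :: "real \<Rightarrow> real ^ 'n \<Rightarrow> real ^ 'm \<Rightarrow> 'w \<Rightarrow> real ^ 'n"
    and g :: "real ^ 'n \<Rightarrow> 'w \<Rightarrow> real"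
    and a :: "'w \<Rightarrow> real" and b c k :: real
  assumes T_pos: "T > 0"
    and \<Omega>_compact: "compact (UNIV :: 'w set)"
    and M_radon: "finite_radon_measure M"
    and UU_compact: "compact UU"
    and U_usc: "usc_map_on {0..T} U"
    and U_values: "\<And>t. t \<in> {0..T} \<Longrightarrow> U t \<noteq> {} \<and> compact (U t) \<and> U t \<subseteq> UU"
    and f_measurable:
      "\<And>x v \<omega>. (\<lambda>t. f t x v \<omega>) \<in> borel_measurable (lebesgue_on {0..T})"
    and f_continuous:
      "\<And>t. t \<in> {0..T} \<Longrightarrow> continuous_on UNIV (\<lambda>(x, v, \<omega>). f t x v \<omega>)"
    and ck_pos: "c > 0" "k > 0"
    and f_growth:
      "AE t in lebesgue_on {0..T}. \<forall>x v \<omega>. norm (f t x v \<omega>) \<le> c * (1 + norm x)"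
    and f_lipschitz:
      "AE t in lebesgue_on {0..T}. \<forall>x x' v \<omega>.
         norm (f t x v \<omega> - f t x' v \<omega>) \<le> k * norm (x - x')"
    and g_measurable:
      "(\<lambda>(x, \<omega>). g x \<omega>) \<in> borel_measurable ((lebesgue :: (real ^ 'n) measure) \<Otimes>\<^sub>M M)"
    and g_lsc: "\<And>\<omega>. lsc (\<lambda>x. g x \<omega>)"
    and a_integrable: "integrable M a"
    and b_nonneg: "b \<ge> 0"
    and g_bound: "\<And>x \<omega>. g x \<omega> \<ge> a \<omega> - b * (norm x)\<^sup>2"
  shows
    "(\<forall>\<phi>\<in>L2 M. \<forall>s1\<in>{0..T}. \<forall>s2\<in>{0..T}. s1 \<le> s2 \<longrightarrow>
        (\<forall>u\<in>Uad U s1 s2. \<forall>x. trajectory M f s1 s2 \<phi> u x \<longrightarrow>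
           value_function T M U f g s1 \<phi> \<le> value_function T M U f g s2 (x s2)))
     \<and>
     (\<forall>\<phi>\<in>L2 M. \<forall>s1\<in>{0..T}. \<forall>s2\<in>{0..T}. s1 \<le> s2 \<longrightarrow>
        value_function T M U f g s1 \<phi> =
          Inf {value_function T M U f g s2 (x s2) | u x.
                 u \<in> Uad U s1 T \<and> trajectory M f s1 T \<phi> u x})"
proof (intro conjI ballI impI allI)
  fix \<phi> s1 s2 u x
  assume "s2 \<in> {0..T}" "s1 \<le> s2" "u \<in> Uad U s1 s2" "trajectory M f s1 s2 \<phi> u x"
  then show "value_function T M U f g s1 \<phi> \<le> value_function T M U f g s2 (x s2)"
    using value_function_le_along_trajectory[of s1 s2 T u U M f \<phi> x g] by simp
next
  fix \<phi> s1 s2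
  assume "s2 \<in> {0..T}" "s1 \<le> s2"
  then show "value_function T M U f g s1 \<phi> =
      Inf {value_function T M U f g s2 (x s2) | u x.
             u \<in> Uad U s1 T \<and> trajectory M f s1 T \<phi> u x}"
    using value_function_dynamic_programming[of s1 s2 T M U f g \<phi>] by simp
qed

end
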